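(* Let $\pi$ be a commutative semigroup and let $(\{A_\varphi\}_{\varphi\in\pi},\{\prec_{p,q}\}_{p,q\in\pi},\{\succ_{p,q}\}_{p,q\in\pi})$ be a dendriform T-algebra. Then $(\{A_\varphi\}_{\varphi\in\pi},\{\ast_{p,q}\}_{p,q\in\pi})$ is a pre-Lie T-algebra, where $\ast_{p,q}:A_p\otimes A_q\to A_{pq}$ is defined by $$a\ast_{p,q}b:=a\succ_{p,q}b-b\prec_{q,p}a$$ for $a\in A_p$, $b\in A_q$ and $p,q\in\pi$.
   Context: $K$ is a field; all vector spaces, tensor products and linear maps are over $K$. A dendriform T-algebra (for a semigroup $\pi$) is a family of vector spaces $\{A_\varphi\}_{\varphi\in\pi}$ with bilinear operations (linear maps) $\prec_{p,q},\succ_{p,q}:A_p\otimes A_q\to A_{pq}$ such that for all $p,q,t\in\pi$, $a\in A_p,b\in A_q,c\in A_t$: $(a\prec_{p,q}b)\prec_{pq,t}c=a\prec_{p,qt}(b\prec_{q,t}c+b\succ_{q,t}c)$; $(a\succ_{p,q}b)\prec_{pq,t}c=a\succ_{p,qt}(b\prec_{q,t}c)$; $(a\prec_{p,q}b+a\succ_{p,q}b)\succ_{pq,t}c=a\succ_{p,qt}(b\succ_{q,t}c)$. For a commutative semigroup $\pi$, a pre-Lie T-algebra is a family of vector spaces $\{A_\varphi\}_{\varphi\in\pi}$ with bilinear operations $\ast_{p,q}:A_p\otimes A_q\to A_{pq}$ such that $a\ast_{p,qt}(b\ast_{q,t}c)-(a\ast_{p,q}b)\ast_{pq,t}c=b\ast_{q,pt}(a\ast_{p,t}c)-(b\ast_{q,p}a)\ast_{qp,t}c$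 for all $p,q,t\in\pi$, $a\in A_p,b\in A_q,c\in A_t$. *)

theory Defs
  imports "HOL-Algebra.Module"
begin

text \<open>
  A linear map out of a tensor product \<open>M \<otimes> N \<rightarrow> P\<close> is represented, as usual, by the corresponding
  bilinear map. Values outside the carriers are irrelevant.
\<close>

locale bilinear_map =
  M: module K M + N: module K N + P: module K P
  for K (structure) and M and N and P +
  fixes f :: "'a \<Rightarrow> 'b \<Rightarrow> 'c"
  assumes closed: "\<lbrakk>x \<in> carrier M; y \<in> carrier N\<rbrakk> \<Longrightarrow> f x y \<in> carrier P"
    and add_left: "\<lbrakk>x \<in> carrier M; x' \<in> carrier M; y \<in> carrier N\<rbrakk>
      \<Longrightarrow> f (x \<oplus>\<^bsub>M\<^esub> x') y = f x y \<oplus>\<^bsub>P\<^esub> f x' y"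
    and add_right: "\<lbrakk>x \<in> carrier M; y \<in> carrier N; y' \<in> carrier N\<rbrakk>
      \<Longrightarrow> f x (y \<oplus>\<^bsub>N\<^esub> y') = f x y \<oplus>\<^bsub>P\<^esub> f x y'"
    and smult_left: "\<lbrakk>r \<in> carrier K; x \<in> carrier M; y \<in> carrier N\<rbrakk>
      \<Longrightarrow> f (r \<odot>\<^bsub>M\<^esub> x) y = r \<odot>\<^bsub>P\<^esub> f x y"
    and smult_right: "\<lbrakk>r \<in> carrier K; x \<in> carrier M; y \<in> carrier N\<rbrakk>
      \<Longrightarrow> f x (r \<odot>\<^bsub>N\<^esub> y) = r \<odot>\<^bsub>P\<^esub> f x y"

text \<open>
  The semigroup is a type of class \<open>semigroup_mult\<close> (\<open>ab_semigroup_mult\<close> in the commutative case).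
  The vector spaces \<open>A p\<close> share an ambient type of elements, but each has its own carrier, addition
  and scalar multiplication, so they need not be related to one another in any way.
\<close>

locale vector_space_family = field K
  for K :: "('k, 'm) ring_scheme" (structure) +
  fixes A :: "'p \<Rightarrow> ('k, 'v, 'n) module_scheme"
  assumes vector_space: "module K (A p)"

text \<open>
  The operation carrying the indices \<open>p, q\<close> is \<open>prec p q\<close>, respectively \<open>succ p q\<close>.
\<close>

locale dendriform_T_algebra = vector_space_family K A
  for K :: "('k, 'm) ring_scheme" (structure)
    and A :: "'p::semigroup_mult \<Rightarrow> ('k, 'v, 'n) module_scheme" +
  fixes prec succ :: "'p \<Rightarrow> 'p \<Rightarrow> 'v \<Rightarrow> 'v \<Rightarrow> 'v"
  assumes prec_bilinear: "bilinear_map K (A p) (A q) (A (p * q)) (prec p q)"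
    and succ_bilinear: "bilinear_map K (A p) (A q) (A (p * q)) (succ p q)"
    and prec_prec: "\<lbrakk>a \<in> carrier (A p); b \<in> carrier (A q); c \<in> carrier (A t)\<rbrakk>
      \<Longrightarrow> prec (p * q) t (prec p q a b) c
        = prec p (q * t) a (prec q t b c \<oplus>\<^bsub>A (q * t)\<^esub> succ q t b c)"
    and succ_prec: "\<lbrakk>a \<in> carrier (A p); b \<in> carrier (A q); c \<in> carrier (A t)\<rbrakk>
      \<Longrightarrow> prec (p * q) t (succ p q a b) c = succ p (q * t) a (prec q t b c)"
    and succ_succ: "\<lbrakk>a \<in> carrier (A p); b \<in> carrier (A q); c \<in> carrier (A t)\<rbrakk>
      \<Longrightarrow> succ (p * q) t (prec p q a b \<oplus>\<^bsub>A (p * q)\<^esub> succ p q a b) c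
        = succ p (q * t) a (succ q t b c)"

locale pre_Lie_T_algebra = vector_space_family K A
  for K :: "('k, 'm) ring_scheme" (structure)
    and A :: "'p::ab_semigroup_mult \<Rightarrow> ('k, 'v, 'n) module_scheme" +
  fixes ast :: "'p \<Rightarrow> 'p \<Rightarrow> 'v \<Rightarrow> 'v \<Rightarrow> 'v"
  assumes ast_bilinear: "bilinear_map K (A p) (A q) (A (p * q)) (ast p q)"
    and pre_Lie: "\<lbrakk>a \<in> carrier (A p); b \<in> carrier (A q); c \<in> carrier (A t)\<rbrakk>
      \<Longrightarrow> ast p (q * t) a (ast q t b c) \<ominus>\<^bsub>A (p * q * t)\<^esub> ast (p * q) t (ast p q a b) c
        = ast q (p * t) b (ast p t a c) \<ominus>\<^bsub>A (q * p * t)\<^esub> ast (q * p) t (ast q p b a) c"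

end

theory Submission
  imports Defs
begin

text \<open>
  Writing \<open>\<prec>\<close>, \<open>\<succ>\<close> for the dendriform operations, the three axioms turn the associator
  \<open>a \<ast> (b \<ast> c) - (a \<ast> b) \<ast> c\<close> into
  \<open>(a \<prec> b) \<succ> c + (b \<prec> a) \<succ> c + c \<prec> (a \<succ> b) + c \<prec> (b \<succ> a) - a \<succ> (c \<prec> b) - b \<succ> (c \<prec> a)\<close>,
  which is visibly symmetric in \<open>a\<close> and \<open>b\<close>.
\<close>

context bilinear_map
begin

lemma minus_right:
  assumes "x \<in> carrier M" "y \<in> carrier N" "y' \<in> carrier N"
  shows "f x (y \<ominus>\<^bsub>N\<^esub> y') = f x y \<ominus>\<^bsub>P\<^esub> f x y'"
proof -
  have "f x (y \<ominus>\<^bsub>N\<^esub> y') \<oplus>\<^bsub>P\<^esub> f x y' = f x ((y \<ominus>\<^bsub>N\<^esub> y') \<oplus>\<^bsub>N\<^esub> y')"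
    using assms by (simp add: add_right)
  also have "(y \<ominus>\<^bsub>N\<^esub> y') \<oplus>\<^bsub>N\<^esub> y' = y"
    using assms by (simp add: a_minus_def N.a_assoc N.l_neg)
  finally have "f x y = f x (y \<ominus>\<^bsub>N\<^esub> y') \<oplus>\<^bsub>P\<^esub> f x y'" by simp
  then show ?thesis
    using assms by (simp add: a_minus_def P.a_assoc P.r_neg closed)
qed

lemma minus_left:
  assumes "x \<in> carrier M" "x' \<in> carrier M" "y \<in> carrier N"
  shows "f (x \<ominus>\<^bsub>M\<^esub> x') y = f x y \<ominus>\<^bsub>P\<^esub> f x' y"
proof -
  have "f (x \<ominus>\<^bsub>M\<^esub> x') y \<oplus>\<^bsub>P\<^esub> f x' y = f ((x \<ominus>\<^bsub>M\<^esub> x') \<oplus>\<^bsub>M\<^esub> x') y"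
    using assms by (simp add: add_left)
  also have "(x \<ominus>\<^bsub>M\<^esub> x') \<oplus>\<^bsub>M\<^esub> x' = x"
    using assms by (simp add: a_minus_def M.a_assoc M.l_neg)
  finally have "f x y = f (x \<ominus>\<^bsub>M\<^esub> x') y \<oplus>\<^bsub>P\<^esub> f x' y" by simp
  then show ?thesis
    using assms by (simp add: a_minus_def P.a_assoc P.r_neg closed)
qed

end

text \<open>Gives bilinearity of \<open>ast\<close>, with \<open>f\<close> as
  \<open>succ p q\<close> and \<open>g\<close> as \<open>prec q p\<close>. The flip turns the left
  laws of \<open>g\<close> into right laws and conversely, and differences respect sums and scalars
  in \<open>P\<close>.\<close>

lemma bilinear_map_diff_flip:
  assumes "bilinear_map K M N P f" and "bilinear_map K N M P g"
  shows "bilinear_map K M N P (\<lambda>x y. f x y \<ominus>\<^bsub>P\<^esub> g y x)"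
proof -
  interpret f: bilinear_map K M N P f by fact
  interpret g: bilinear_map K N M P g by fact
  show ?thesis
    by unfold_locales
      (simp_all add: f.closed g.closed f.add_left g.add_left f.add_right g.add_right
        f.smult_left g.smult_left f.smult_right g.smult_right a_minus_def
        f.P.minus_add f.P.a_ac f.P.smult_r_distr f.P.smult_r_minus)
qed

text \<open>The letters stand for x = (a \<prec> b) \<succ> c, x' = (a \<succ> b) \<succ> c, y = (b
  \<prec> a) \<succ> c, u = a \<succ> (c \<prec> b), v = b \<succ> (c \<prec> a), w = c \<prec> (a
  \<succ> b), z = c \<prec> (b \<prec> a), z' = c \<prec> (b \<succ> a). Both x' and z occur once in
  each half of the associator and cancel.\<close>

lemma (in abelian_group) associator_cancel:
  assumes "x \<in> carrier G" "x' \<in> carrier G" "y \<in> carrier G" "u \<in> carrier G"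
    "v \<in> carrier G" "w \<in> carrier G" "z \<in> carrier G" "z' \<in> carrier G"
  shows "((x \<oplus> x') \<ominus> u \<ominus> (v \<ominus> (z \<oplus> z'))) \<ominus> ((x' \<ominus> y) \<ominus> (w \<ominus> z))
    = (x \<oplus> y) \<oplus> (w \<oplus> z') \<ominus> (u \<oplus> v)"
proof -
  \<comment> \<open>The cancelling pairs stay visible on the right, so both sides agree by
    rearrangement alone; \<open>r_neg\<close> is held back to keep these pairs until the
    end.\<close>
  have "((x \<oplus> x') \<ominus> u \<ominus> (v \<ominus> (z \<oplus> z'))) \<ominus> ((x' \<ominus> y) \<ominus> (w \<ominus> z))
    = ((x \<oplus> y) \<oplus> (w \<oplus> z') \<ominus> (u \<oplus> v)) \<oplus> ((x' \<oplus> \<ominus> x') \<oplus> (z \<oplus> \<ominus> z))"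
    using assms by (simp add: a_minus_def minus_add a_ac del: r_neg)
  then show ?thesis
    using assms by (simp add: r_neg)
qed

text \<open>
  Inside the locale the index type is only of class \<open>semigroup_mult\<close>, so commutativity is a hypothesis.
\<close>

lemma (in dendriform_T_algebra) associator_eq:
  fixes ast
  assumes comm: "\<And>p q :: 'p. p * q = q * p"
    and abc: "a \<in> carrier (A p)" "b \<in> carrier (A q)" "c \<in> carrier (A t)"
  defines "ast \<equiv> \<lambda>p q a b. succ p q a b \<ominus>\<^bsub>A (p * q)\<^esub> prec q p b a"
  shows "ast p (q * t) a (ast q t b c) \<ominus>\<^bsub>A (p * q * t)\<^esub> ast (p * q) t (ast p q a b) c
    = (succ (p * q) t (prec p q a b) c \<oplus>\<^bsub>A (p * q * t)\<^esub> succ (p * q) t (prec q p b a) c)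
        \<oplus>\<^bsub>A (p * q * t)\<^esub> (prec t (p * q) c (succ p q a b) \<oplus>\<^bsub>A (p * q * t)\<^esub> prec t (p * q) c (succ q p b a))
        \<ominus>\<^bsub>A (p * q * t)\<^esub> (succ p (q * t) a (prec t q c b) \<oplus>\<^bsub>A (p * q * t)\<^esub> succ q (p * t) b (prec t p c a))"
proof -
  interpret R: module K "A (p * q * t)" by (rule vector_space)
  note bil = prec_bilinear succ_bilinear
  note closed = bil[THEN bilinear_map.closed]
  \<comment> \<open>Equal products index the same space, but the axioms and bilinearity laws name it
    by different terms; these equations bring the indices to one form.\<close>
  have idx: "p * (q * t) = p * q * t" "q * t * p = p * q * t" "t * (p * q) = p * q * t"
    "q * (p * t) = p * q * t" "q * p = p * q" "t * q = q * t" "t * p = p * t"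
    by (metis comm mult.assoc)+
  have in2: "prec p q a b \<in> carrier (A (p * q))" "succ p q a b \<in> carrier (A (p * q))"
    "prec q p b a \<in> carrier (A (p * q))" "succ q p b a \<in> carrier (A (p * q))"
    "succ q t b c \<in> carrier (A (q * t))" "prec t q c b \<in> carrier (A (q * t))"
    "prec t p c a \<in> carrier (A (p * t))"
    using closed[of a p b q] closed[of b q a p] closed[of b q c t] closed[of c t b q]
      closed[of c t a p] abc
    by (simp_all add: idx)
  have in3: "succ (p * q) t x c \<in> carrier (A (p * q * t))"
      "prec t (p * q) c x \<in> carrier (A (p * q * t))" if "x \<in> carrier (A (p * q))" for x
    using closed(2)[of x "p * q" c t] closed(1)[of c t x "p * q"] that abc by (simp_all add: idx)
  have in3': "succ p (q * t) a x \<in> carrier (A (p * q * t))"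
      "prec (q * t) p x a \<in> carrier (A (p * q * t))" if "x \<in> carrier (A (q * t))" for x
    using closed(2)[of a p x "q * t"] closed(1)[of x "q * t" a p] that abc by (simp_all add: idx)
  have in3'': "succ q (p * t) b (prec t p c a) \<in> carrier (A (p * q * t))"
    using closed(2)[of b q "prec t p c a" "p * t"] abc in2 by (simp add: idx)
  \<comment> \<open>The dendriform axioms enter here: the third at (a, b, c), the first at (c, b, a)
    and the second at (b, c, a). Additivity splits the inner sums of the first two.\<close>
  have ss: "succ p (q * t) a (succ q t b c)
      = succ (p * q) t (prec p q a b) c \<oplus>\<^bsub>A (p * q * t)\<^esub> succ (p * q) t (succ p q a b) c"
    using succ_succ[OF abc] bilinear_map.add_left[OF succ_bilinear in2(1,2) abc(3)] by simp
  have pp: "prec (q * t) p (prec t q c b) a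
      = prec t (p * q) c (prec q p b a) \<oplus>\<^bsub>A (p * q * t)\<^esub> prec t (p * q) c (succ q p b a)"
    using prec_prec[OF abc(3,2,1)] bilinear_map.add_right[OF prec_bilinear abc(3) in2(3,4)]
    by (simp add: idx)
  have sp: "prec (q * t) p (succ q t b c) a = succ q (p * t) b (prec t p c a)"
    using succ_prec[OF abc(2,3,1)] by (simp add: idx)
  \<comment> \<open>Nesting puts a difference inside \<open>succ\<close> and \<open>prec\<close>,
    which distribute over it by bilinearity.\<close>
  have "ast p (q * t) a (ast q t b c)
      = (succ p (q * t) a (succ q t b c) \<ominus>\<^bsub>A (p * q * t)\<^esub> succ p (q * t) a (prec t q c b))
        \<ominus>\<^bsub>A (p * q * t)\<^esub> (prec (q * t) p (succ q t b c) a
          \<ominus>\<^bsub>A (p * q * t)\<^esub> prec (q * t) p (prec t q c b) a)"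
    using bilinear_map.minus_right[OF succ_bilinear abc(1) in2(5,6)]
      bilinear_map.minus_left[OF prec_bilinear in2(5,6) abc(1)]
    by (simp add: ast_def idx)
  moreover have "ast (p * q) t (ast p q a b) c
      = (succ (p * q) t (succ p q a b) c \<ominus>\<^bsub>A (p * q * t)\<^esub> succ (p * q) t (prec q p b a) c)
        \<ominus>\<^bsub>A (p * q * t)\<^esub> (prec t (p * q) c (succ p q a b)
          \<ominus>\<^bsub>A (p * q * t)\<^esub> prec t (p * q) c (prec q p b a))"
    using bilinear_map.minus_left[OF succ_bilinear in2(2,3) abc(3)]
      bilinear_map.minus_right[OF prec_bilinear abc(3) in2(2,3)]
    by (simp add: ast_def idx)
  ultimately show ?thesis
    unfolding ss pp sp
    by (simp only: R.associator_cancel in2 in3 in3' in3'')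
qed

theorem proposition4p3:
  fixes K :: "('k, 'm) ring_scheme"
    and A :: "'p::ab_semigroup_mult \<Rightarrow> ('k, 'v, 'n) module_scheme"
    and prec succ :: "'p \<Rightarrow> 'p \<Rightarrow> 'v \<Rightarrow> 'v \<Rightarrow> 'v"
  assumes "dendriform_T_algebra K A prec succ"
  shows "pre_Lie_T_algebra K A (\<lambda>p q a b. succ p q a b \<ominus>\<^bsub>A (p * q)\<^esub> prec q p b a)"
proof -
  interpret dendriform_T_algebra K A prec succ by fact
  show ?thesis
  proof (intro pre_Lie_T_algebra.intro pre_Lie_T_algebra_axioms.intro
      vector_space_family_axioms, goal_cases)
    case (1 p q)
    \<comment> \<open>By commutativity \<open>prec q p\<close> also lands in
      \<open>A (p * q)\<close>, so the difference makes sense there.\<close>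
    show ?case
      using bilinear_map_diff_flip[OF succ_bilinear[of p q], of "prec q p"]
        prec_bilinear[of q p] by (simp add: mult.commute)
  next
    case (2 a p b q c t)
    interpret R: module K "A (p * q * t)" by (rule vector_space)
    have idx: "q * p = p * q" "t * (p * q) = p * q * t" "p * (q * t) = p * q * t"
      "q * (p * t) = p * q * t" "t * q = q * t" "t * p = p * t"
      by (simp_all add: mult_ac)
    note bil = prec_bilinear succ_bilinear
    note closed = bil[THEN bilinear_map.closed]
    have in2: "prec p q a b \<in> carrier (A (p * q))" "succ p q a b \<in> carrier (A (p * q))"
      "prec q p b a \<in> carrier (A (p * q))" "succ q p b a \<in> carrier (A (p * q))"
      "prec t q c b \<in> carrier (A (q * t))" "prec t p c a \<in> carrier (A (p * t))"
      using closed[of a p b q] closed[of b q a p] closed[of c t b q] closed[of c t a p] 2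
      by (simp_all add: idx)
    have in3: "succ (p * q) t (prec p q a b) c \<in> carrier (A (p * q * t))"
      "succ (p * q) t (prec q p b a) c \<in> carrier (A (p * q * t))"
      "prec t (p * q) c (succ p q a b) \<in> carrier (A (p * q * t))"
      "prec t (p * q) c (succ q p b a) \<in> carrier (A (p * q * t))"
      "succ p (q * t) a (prec t q c b) \<in> carrier (A (p * q * t))"
      "succ q (p * t) b (prec t p c a) \<in> carrier (A (p * q * t))"
      using closed(2)[of _ "p * q" c t] closed(1)[of c t _ "p * q"]
        closed(2)[of a p _ "q * t"] closed(2)[of b q _ "p * t"] in2 2
      by (simp_all add: idx)
    show ?case
      \<comment> \<open>The second instance swaps a with b and p with q. Once \<open>q * p\<close>
        becomes \<open>p * q\<close>, the two expansions differ only in the order of summands within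
        the three bracketed sums.\<close>
      unfolding associator_eq[OF mult.commute 2] associator_eq[OF mult.commute 2(2,1,3)]
      unfolding idx(1)
      by (simp only: in3 R.a_comm R.add.m_closed)
  qed
qed

end
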